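(* If $M$ is a commutative monoid, regarded as a plasma with $a\boxplus b=\{a+b\}$, then the $\mathbb{F}_1$-modules $HM$ and $\hat{H}M$ are naturally isomorphic as functors $\mathsf{Fin}_\ast\to\mathsf{Set}_\ast$.
   Context: Plasmas. A plasma is a triple $(M,\boxplus,e)$ with $M$ a set, $\boxplus\colon M\times M\to\mathcal{P}(M)$ a function to the power set of $M$ and $e\in M$, such that $a\in e\boxplus a$ for all $a\in M$ and $a\boxplus b=b\boxplus a$ for all $a,b\in M$. $\mathbb{F}_1$-modules. $\mathsf{Fin}_\ast$ is the category whose objects are the pointed sets $\langle n\rangle=\{0,1,\ldots,n\}$, $n\ge 0$, with basepoint $0$, and whose morphisms are pointed functions; $\mathsf{Set}_\ast$ is the category of pointed sets. An $\mathbb{F}_1$-module is a functor $X\colon\mathsf{Fin}_\ast\to\mathsf{Set}_\ast$ such that $X(\langle 0\rangle)$ is a singleton. Segal's functor $H$. For a commutative monoid $(A,+,0)$, $HA\colon\mathsf{Fin}_\ast\to\mathsf{Set}_\ast$ is given by $HA_n=A^n$ (pointed by $(0,\ldots,0)$), and $\phi\colon\langle n\rangle\to\langle m\rangle$ acts by $(a_1,\ldots,a_n)\mapsto\left(\sum_{i\in\phi^{-1}(j)}a_i\right)_{1\le j\le m}$. The functor $\hat{H}$. Write $[n]=\{1,\ldots,n\}$. For a plasma $(M,\boxplus,0)$, $\hat{H}M$ is the $\mathbb{F}_1$-module with $$\hat{H}M_n=\{(x_S)_{S\subseteq[n]}: x_S\in M,\ x_\varnothing=0,\ x_{S\cup T}\in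 x_S\boxplus x_T\text{ whenever }S\cap T=\varnothing\},$$ pointed by the constant family $0$, where $\phi\colon\langle n\rangle\to\langle m\rangle$ acts by $(x_S)_{S\subseteq[n]}\mapsto (x_{\phi^{-1}(T)})_{T\subseteq[m]}$. *)

theory Defs
  imports "HOL-Algebra.FiniteProduct"
begin

section \<open>Plasmas\<close>

record 'a plasma = "'a partial_object" +
  hyperadd :: "'a \<Rightarrow> 'a \<Rightarrow> 'a set"
  neutral :: 'a

locale plasma =
  fixes P :: "('a, 'b) plasma_scheme"
  assumes neutral_closed: "neutral P \<in> carrier P"
    and hyperadd_closed:
      "\<lbrakk>a \<in> carrier P; b \<in> carrier P\<rbrakk> \<Longrightarrow> hyperadd P a b \<subseteq> carrier P"
    and hyperadd_neutral: "a \<in> carrier P \<Longrightarrow> a \<in> hyperadd P (neutral P) a"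
    and hyperadd_commute:
      "\<lbrakk>a \<in> carrier P; b \<in> carrier P\<rbrakk> \<Longrightarrow> hyperadd P a b = hyperadd P b a"

text \<open>Commutative monoids are the multiplicatively written ones of HOL-Algebra, so the sum
  \<open>a + b\<close> is \<open>a \<otimes> b\<close> and the neutral element \<open>0\<close> is \<open>\<one>\<close>.\<close>

definition plasma_of_monoid :: "('a, 'b) monoid_scheme \<Rightarrow> 'a plasma" where
  "plasma_of_monoid M =
     \<lparr>carrier = carrier M, hyperadd = (\<lambda>a b. {a \<otimes>\<^bsub>M\<^esub> b}), neutral = \<one>\<^bsub>M\<^esub>\<rparr>"

lemma (in comm_monoid) plasma_plasma_of_monoid: "plasma (plasma_of_monoid G)"
  by unfold_locales (auto simp: plasma_of_monoid_def m_comm)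


section \<open>Pointed sets and functors from finite pointed sets\<close>

text \<open>Morphisms are extensional functions (\<open>undefined\<close> off their domain), so that equality
  of morphisms between fixed objects is HOL equality.\<close>

definition fin_hom :: "nat \<Rightarrow> nat \<Rightarrow> (nat \<Rightarrow> nat) set" where
  "fin_hom n m = {\<phi> \<in> {0..n} \<rightarrow>\<^sub>E {0..m}. \<phi> 0 = 0}"

definition fin_id :: "nat \<Rightarrow> nat \<Rightarrow> nat" where
  "fin_id n = (\<lambda>i\<in>{0..n}. i)"

definition fin_comp :: "nat \<Rightarrow> (nat \<Rightarrow> nat) \<Rightarrow> (nat \<Rightarrow> nat) \<Rightarrow> nat \<Rightarrow> nat" where
  "fin_comp n \<psi> \<phi> = compose {0..n} \<psi> \<phi>"

type_synonym 'x pointed = "'x set \<times> 'x"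

definition pointed_set :: "'x pointed \<Rightarrow> bool" where
  "pointed_set A \<longleftrightarrow> snd A \<in> fst A"

definition pointed_hom :: "'x pointed \<Rightarrow> 'y pointed \<Rightarrow> ('x \<Rightarrow> 'y) set" where
  "pointed_hom A B = {f \<in> fst A \<rightarrow>\<^sub>E fst B. f (snd A) = snd B}"

definition pointed_id :: "'x pointed \<Rightarrow> 'x \<Rightarrow> 'x" where
  "pointed_id A = (\<lambda>x\<in>fst A. x)"

definition pointed_comp :: "'x pointed \<Rightarrow> ('y \<Rightarrow> 'z) \<Rightarrow> ('x \<Rightarrow> 'y) \<Rightarrow> 'x \<Rightarrow> 'z" where
  "pointed_comp A g f = compose (fst A) g f"

definition pointed_iso :: "'x pointed \<Rightarrow> 'y pointed \<Rightarrow> ('x \<Rightarrow> 'y) set" where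
  "pointed_iso A B =
     {f \<in> pointed_hom A B. \<exists>g \<in> pointed_hom B A.
        pointed_comp A g f = pointed_id A \<and> pointed_comp B f g = pointed_id B}"

text \<open>\<open>arr X n m \<phi>\<close> is the action of \<open>X\<close> on \<open>\<phi> : \<langle>n\<rangle> \<rightarrow> \<langle>m\<rangle>\<close>; since \<open>\<phi>\<close> is a bare HOL function,
  its source and target are passed along. It is only meaningful for \<open>\<phi> \<in> fin_hom n m\<close>.\<close>

record 'x fin_functor =
  obj :: "nat \<Rightarrow> 'x pointed"
  arr :: "nat \<Rightarrow> nat \<Rightarrow> (nat \<Rightarrow> nat) \<Rightarrow> 'x \<Rightarrow> 'x"

locale pointed_functor =
  fixes X :: "'x fin_functor"
  assumes obj_pointed: "pointed_set (obj X n)"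
    and arr_hom: "\<phi> \<in> fin_hom n m \<Longrightarrow> arr X n m \<phi> \<in> pointed_hom (obj X n) (obj X m)"
    and arr_id: "arr X n n (fin_id n) = pointed_id (obj X n)"
    and arr_comp: "\<lbrakk>\<phi> \<in> fin_hom n m; \<psi> \<in> fin_hom m k\<rbrakk> \<Longrightarrow>
      arr X n k (fin_comp n \<psi> \<phi>) = pointed_comp (obj X n) (arr X m k \<psi>) (arr X n m \<phi>)"

locale F1_module = pointed_functor +
  assumes obj_zero: "\<exists>x. fst (obj X 0) = {x}"

locale natural_transformation =
  source: pointed_functor X + target: pointed_functor Y
  for X :: "'x fin_functor" and Y :: "'y fin_functor" +
  fixes \<eta> :: "nat \<Rightarrow> 'x \<Rightarrow> 'y"
  assumes component_hom: "\<eta> n \<in> pointed_hom (obj X n) (obj Y n)"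
    and naturality: "\<phi> \<in> fin_hom n m \<Longrightarrow>
      pointed_comp (obj X n) (\<eta> m) (arr X n m \<phi>) = pointed_comp (obj X n) (arr Y n m \<phi>) (\<eta> n)"

locale natural_isomorphism = natural_transformation +
  assumes component_iso: "\<eta> n \<in> pointed_iso (obj X n) (obj Y n)"

definition naturally_isomorphic :: "'x fin_functor \<Rightarrow> 'y fin_functor \<Rightarrow> bool" where
  "naturally_isomorphic X Y \<longleftrightarrow> (\<exists>\<eta>. natural_isomorphism X Y \<eta>)"


section \<open>The functors \<open>H\<close> and \<open>hat H\<close>\<close>

text \<open>An \<open>n\<close>-tuple is an extensional function on \<open>{1..n}\<close>, and a family indexed by the subsets
  of \<open>[n]\<close> is an extensional function on \<open>Pow {1..n}\<close>.\<close>

definition segal_H :: "('a, 'b) monoid_scheme \<Rightarrow> (nat \<Rightarrow> 'a) fin_functor" where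
  "segal_H A =
     \<lparr>obj = (\<lambda>n. ({1..n} \<rightarrow>\<^sub>E carrier A, \<lambda>i\<in>{1..n}. \<one>\<^bsub>A\<^esub>)),
      arr = (\<lambda>n m \<phi>. \<lambda>a \<in> {1..n} \<rightarrow>\<^sub>E carrier A.
               \<lambda>j\<in>{1..m}. \<Otimes>\<^bsub>A\<^esub>i\<in>{i \<in> {0..n}. \<phi> i = j}. a i)\<rparr>"

definition hat_H_set :: "('a, 'b) plasma_scheme \<Rightarrow> nat \<Rightarrow> (nat set \<Rightarrow> 'a) set" where
  "hat_H_set P n =
     {x \<in> Pow {1..n} \<rightarrow>\<^sub>E carrier P.
        x {} = neutral P \<and>
        (\<forall>S T. S \<subseteq> {1..n} \<and> T \<subseteq> {1..n} \<and> S \<inter> T = {} \<longrightarrow>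
           x (S \<union> T) \<in> hyperadd P (x S) (x T))}"

definition hat_H :: "('a, 'b) plasma_scheme \<Rightarrow> (nat set \<Rightarrow> 'a) fin_functor" where
  "hat_H P =
     \<lparr>obj = (\<lambda>n. (hat_H_set P n, \<lambda>S \<in> Pow {1..n}. neutral P)),
      arr = (\<lambda>n m \<phi>. \<lambda>x \<in> hat_H_set P n.
               \<lambda>T \<in> Pow {1..m}. x {i \<in> {0..n}. \<phi> i \<in> T})\<rparr>"

end

theory Submission
  imports Defs
begin

text \<open>
  Over a commutative monoid \<open>M\<close> the condition on a family \<open>(x\<^sub>S)\<close> in \<open>hat H M\<^sub>n\<close> reads
  \<open>x\<^bsub>S \<union> T\<^esub> = x\<^sub>S + x\<^sub>T\<close> for disjoint \<open>S\<close>, \<open>T\<close>: the family is a finitely additive measure on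
  the finite set \<open>[n]\<close>. Such a measure is determined by its values on singletons, which may be
  prescribed freely. Hence \<open>a \<mapsto> (\<Sum>i\<in>S. a i)\<^sub>S\<close> is a bijection \<open>M\<^sup>n \<rightarrow> hat H M\<^sub>n\<close> with inverse
  \<open>x \<mapsto> (x\<^bsub>{i}\<^esub>)\<^sub>i\<close> (\<open>hat_H_set_eq_finprod\<close>, \<open>sum_family_iso\<close>).

  Under this identification the action of \<open>\<phi>\<close> on tuples is the push-forward of measures.
  Naturality says that summing \<open>a\<close> over \<open>\<phi>\<^sup>-\<^sup>1(T)\<close> is the same as summing over \<open>j \<in> T\<close> the sums
  over the fibres \<open>\<phi>\<^sup>-\<^sup>1(j)\<close> (\<open>finprod_fibres\<close>). The same regrouping, with \<open>T\<close> a fibre of a second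
  map, is the functoriality of \<open>HM\<close>, while \<open>hat H\<close> is a functor on every plasma simply because
  taking preimages is functorial and preserves disjoint unions.
\<close>

section \<open>Preimages under pointed maps\<close>

text \<open>Subsets of \<open>[m]\<close> omit the basepoint, and so do their preimages because \<open>\<phi> 0 = 0\<close>. This is
  what makes the actions on \<open>H\<close> and \<open>hat H\<close>, which are defined by preimages in \<open>{0..n}\<close>,
  well defined.\<close>

lemma fin_hom_preimage_subset:
  assumes "\<phi> \<in> fin_hom n m" and "T \<subseteq> {1..m}"
  shows "{i \<in> {0..n}. \<phi> i \<in> T} \<subseteq> {1..n}"
proof
  fix i assume "i \<in> {i \<in> {0..n}. \<phi> i \<in> T}"
  moreover from this have "i \<noteq> 0"
    using assms by (auto simp: fin_hom_def intro!: gr0I)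
  ultimately show "i \<in> {1..n}" by auto
qed

lemma fin_hom_fibre_subset:
  assumes "\<phi> \<in> fin_hom n m" and "j \<in> {1..m}"
  shows "{i \<in> {0..n}. \<phi> i = j} \<subseteq> {1..n}"
  using fin_hom_preimage_subset[OF assms(1), of "{j}"] assms(2) by auto

lemma fin_hom_range: "\<phi> \<in> fin_hom n m \<Longrightarrow> i \<le> n \<Longrightarrow> \<phi> i \<le> m"
  by (auto simp: fin_hom_def PiE_iff)

lemma fin_id_preimage: "T \<subseteq> {1..n} \<Longrightarrow> {i \<in> {0..n}. fin_id n i \<in> T} = T"
  by (auto simp: fin_id_def)

lemma fin_comp_preimage:
  assumes "\<phi> \<in> fin_hom n m"
  shows "{i \<in> {0..n}. fin_comp n \<psi> \<phi> i \<in> T} = {i \<in> {0..n}. \<phi> i \<in> {j \<in> {0..m}. \<psi> j \<in> T}}"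
  using fin_hom_range[OF assms] by (auto simp: fin_comp_def compose_def)


section \<open>The functor \<open>hat H\<close> of a plasma\<close>

lemma hat_H_set_subset: "hat_H_set P n \<subseteq> Pow {1..n} \<rightarrow>\<^sub>E carrier P"
  by (auto simp: hat_H_set_def)

text \<open>Taking preimages commutes with unions and preserves disjointness, so each condition on the
  image family is an instance of a condition on \<open>x\<close>.\<close>

lemma hat_H_arr_closed:
  assumes \<phi>: "\<phi> \<in> fin_hom n m" and x: "x \<in> hat_H_set P n"
  shows "(\<lambda>T \<in> Pow {1..m}. x {i \<in> {0..n}. \<phi> i \<in> T}) \<in> hat_H_set P m"
proof -
  have sub: "{i \<in> {0..n}. \<phi> i \<in> T} \<subseteq> {1..n}" if "T \<subseteq> {1..m}" for T
    using fin_hom_preimage_subset[OF \<phi> that] .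
  have carr: "x S \<in> carrier P" if "S \<subseteq> {1..n}" for S
    using x that by (auto simp: hat_H_set_def PiE_iff)
  have add: "x {i \<in> {0..n}. \<phi> i \<in> S \<union> T}
      \<in> hyperadd P (x {i \<in> {0..n}. \<phi> i \<in> S}) (x {i \<in> {0..n}. \<phi> i \<in> T})"
    if "S \<subseteq> {1..m}" "T \<subseteq> {1..m}" "S \<inter> T = {}" for S T
  proof -
    have "{i \<in> {0..n}. \<phi> i \<in> S \<union> T} = {i \<in> {0..n}. \<phi> i \<in> S} \<union> {i \<in> {0..n}. \<phi> i \<in> T}"
      by auto
    moreover have "{i \<in> {0..n}. \<phi> i \<in> S} \<inter> {i \<in> {0..n}. \<phi> i \<in> T} = {}"
      using that(3) by auto
    ultimately show ?thesis
      using x sub[OF that(1)] sub[OF that(2)] unfolding hat_H_set_def by simp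
  qed
  have empty: "x {} = neutral P"
    using x by (simp add: hat_H_set_def)
  show ?thesis
    unfolding hat_H_set_def using carr[OF sub] add empty by simp
qed

lemma (in plasma) hat_H_F1_module: "F1_module (hat_H P)"
proof
  show "pointed_set (obj (hat_H P) n)" for n
    using neutral_closed hyperadd_neutral[OF neutral_closed]
    by (auto simp: pointed_set_def hat_H_def hat_H_set_def)
  show "arr (hat_H P) n m \<phi> \<in> pointed_hom (obj (hat_H P) n) (obj (hat_H P) m)"
    if \<phi>: "\<phi> \<in> fin_hom n m" for \<phi> n m
  proof -
    let ?e = "\<lambda>S \<in> Pow {1..n}. neutral P"
    have "?e {i \<in> {0..n}. \<phi> i \<in> T} = neutral P" if "T \<in> Pow {1..m}" for T
      using fin_hom_preimage_subset[OF \<phi>, of T] that by (simp only: restrict_apply' Pow_iff)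
    then have "(\<lambda>T \<in> Pow {1..m}. ?e {i \<in> {0..n}. \<phi> i \<in> T}) = (\<lambda>T \<in> Pow {1..m}. neutral P)"
      by (intro restrict_ext)
    moreover have "?e \<in> hat_H_set P n"
      using neutral_closed hyperadd_neutral[OF neutral_closed] by (auto simp: hat_H_set_def)
    ultimately have "arr (hat_H P) n m \<phi> (snd (obj (hat_H P) n)) = snd (obj (hat_H P) m)"
      by (simp only: hat_H_def fin_functor.simps snd_conv restrict_apply')
    moreover have "arr (hat_H P) n m \<phi> \<in> fst (obj (hat_H P) n) \<rightarrow>\<^sub>E fst (obj (hat_H P) m)"
      unfolding hat_H_def fin_functor.simps fst_conv restrict_PiE_iff
      by (intro ballI hat_H_arr_closed[OF \<phi>])
    ultimately show ?thesis
      by (simp add: pointed_hom_def)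
  qed
  show "arr (hat_H P) n n (fin_id n) = pointed_id (obj (hat_H P) n)" for n
  proof -
    have "(\<lambda>T \<in> Pow {1..n}. x {i \<in> {0..n}. fin_id n i \<in> T}) = x" if "x \<in> hat_H_set P n" for x
    proof (rule extensionalityI[where A = "Pow {1..n}"])
      show "x \<in> extensional (Pow {1..n})"
        using that hat_H_set_subset[of P n] by (auto simp: PiE_def)
    qed (auto simp del: atLeastAtMost_iff simp: fin_id_preimage)
    then show ?thesis
      by (auto simp: hat_H_def pointed_id_def intro!: restrict_ext)
  qed
  show "arr (hat_H P) n k (fin_comp n \<psi> \<phi>)
      = pointed_comp (obj (hat_H P) n) (arr (hat_H P) m k \<psi>) (arr (hat_H P) n m \<phi>)"
    if \<phi>: "\<phi> \<in> fin_hom n m" and \<psi>: "\<psi> \<in> fin_hom m k" for \<phi> \<psi> n m k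
  proof -
    have "arr (hat_H P) n k (fin_comp n \<psi> \<phi>) x = arr (hat_H P) m k \<psi> (arr (hat_H P) n m \<phi> x)"
      if x: "x \<in> hat_H_set P n" for x
      using x hat_H_arr_closed[OF \<phi> x] fin_hom_preimage_subset[OF \<psi>]
      by (auto simp: hat_H_def fin_comp_preimage[OF \<phi>]
          simp del: mem_Collect_eq atLeastAtMost_iff intro!: restrict_ext)
    then have "restrict (arr (hat_H P) n k (fin_comp n \<psi> \<phi>)) (fst (obj (hat_H P) n))
        = pointed_comp (obj (hat_H P) n) (arr (hat_H P) m k \<psi>) (arr (hat_H P) n m \<phi>)"
      unfolding pointed_comp_def compose_def by (intro restrict_ext) (simp add: hat_H_def)
    then show ?thesis
      by (simp add: hat_H_def)
  qed
  have "hat_H_set P 0 = {\<lambda>S \<in> {{}}. neutral P}"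
  proof
    have "x = (\<lambda>S \<in> {{}}. neutral P)" if "x \<in> hat_H_set P 0" for x
    proof (rule extensionalityI[where A = "{{}}"])
      show "x \<in> extensional {{}}"
        using that by (simp add: hat_H_set_def PiE_def)
    qed (use that in \<open>simp_all add: hat_H_set_def\<close>)
    then show "hat_H_set P 0 \<subseteq> {\<lambda>S \<in> {{}}. neutral P}"
      by blast
    show "{\<lambda>S \<in> {{}}. neutral P} \<subseteq> hat_H_set P 0"
      using neutral_closed hyperadd_neutral[OF neutral_closed] by (simp add: hat_H_set_def)
  qed
  then show "\<exists>x. fst (obj (hat_H P) 0) = {x}"
    by (simp add: hat_H_def)
qed


section \<open>Segal's functor \<open>H\<close>\<close>

context comm_monoid
begin

text \<open>Regrouping a finite sum along the fibres of \<open>\<phi>\<close>: the only computation behind both the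
  functoriality of \<open>H\<close> and the comparison with \<open>hat H\<close>.\<close>

lemma finprod_fibres:
  assumes \<phi>: "\<phi> \<in> fin_hom n m" and a: "a \<in> {1..n} \<rightarrow> carrier G" and T: "T \<subseteq> {1..m}"
  shows "(\<Otimes>j\<in>T. \<Otimes>i\<in>{i \<in> {0..n}. \<phi> i = j}. a i) = (\<Otimes>i\<in>{i \<in> {0..n}. \<phi> i \<in> T}. a i)"
proof -
  have "a i \<in> carrier G" if "j \<in> T" "i \<in> {i \<in> {0..n}. \<phi> i = j}" for i j
    using a fin_hom_fibre_subset[OF \<phi>, of j] T that by blast
  then have "finprod G a (\<Union>j\<in>T. {i \<in> {0..n}. \<phi> i = j})
      = (\<Otimes>j\<in>T. \<Otimes>i\<in>{i \<in> {0..n}. \<phi> i = j}. a i)"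
    using T by (intro finprod_UN_disjoint) (auto intro: finite_subset simp: pairwise_def disjnt_def)
  moreover have "(\<Union>j\<in>T. {i \<in> {0..n}. \<phi> i = j}) = {i \<in> {0..n}. \<phi> i \<in> T}"
    by auto
  ultimately show ?thesis by simp
qed

lemma segal_H_arr_closed:
  assumes \<phi>: "\<phi> \<in> fin_hom n m" and a: "a \<in> {1..n} \<rightarrow>\<^sub>E carrier G"
  shows "(\<lambda>j\<in>{1..m}. \<Otimes>i\<in>{i \<in> {0..n}. \<phi> i = j}. a i) \<in> {1..m} \<rightarrow>\<^sub>E carrier G"
proof -
  have "(\<Otimes>i\<in>{i \<in> {0..n}. \<phi> i = j}. a i) \<in> carrier G" if "j \<in> {1..m}" for j
    using a fin_hom_fibre_subset[OF \<phi> that] by (intro finprod_closed) blast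
  then show ?thesis by auto
qed

text \<open>With \<open>a\<close> read as a measure on \<open>[n]\<close>, its image under \<open>\<phi>\<close> is the push-forward measure.
  Functoriality of \<open>H\<close> uses this for \<open>T\<close> a fibre of a second map, naturality for arbitrary \<open>T\<close>.\<close>

lemma finprod_segal_H_arr:
  assumes \<phi>: "\<phi> \<in> fin_hom n m" and a: "a \<in> {1..n} \<rightarrow>\<^sub>E carrier G" and T: "T \<subseteq> {1..m}"
  shows "finprod G (arr (segal_H G) n m \<phi> a) T = (\<Otimes>i\<in>{i \<in> {0..n}. \<phi> i \<in> T}. a i)"
proof -
  have "finprod G (arr (segal_H G) n m \<phi> a) T = (\<Otimes>j\<in>T. \<Otimes>i\<in>{i \<in> {0..n}. \<phi> i = j}. a i)"
  proof (rule finprod_cong')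
    show "(\<lambda>j. \<Otimes>i\<in>{i \<in> {0..n}. \<phi> i = j}. a i) \<in> T \<rightarrow> carrier G"
      using PiE_mem[OF segal_H_arr_closed[OF \<phi> a]] T by fastforce
  qed (use a T in \<open>auto simp: segal_H_def\<close>)
  also have "\<dots> = (\<Otimes>i\<in>{i \<in> {0..n}. \<phi> i \<in> T}. a i)"
    using a by (intro finprod_fibres[OF \<phi> _ T]) auto
  finally show ?thesis .
qed

lemma segal_H_F1_module: "F1_module (segal_H G)"
proof
  show "pointed_set (obj (segal_H G) n)" for n
    by (auto simp: pointed_set_def segal_H_def)
  show "arr (segal_H G) n m \<phi> \<in> pointed_hom (obj (segal_H G) n) (obj (segal_H G) m)"
    if \<phi>: "\<phi> \<in> fin_hom n m" for \<phi> n m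
  proof -
    let ?e = "\<lambda>i\<in>{1..n}. \<one>"
    have "finprod G ?e {i \<in> {0..n}. \<phi> i = j} = \<one>" if "j \<in> {1..m}" for j
      using fin_hom_fibre_subset[OF \<phi> that] by (intro finprod_one_eqI) auto
    then have "(\<lambda>j\<in>{1..m}. finprod G ?e {i \<in> {0..n}. \<phi> i = j}) = (\<lambda>j\<in>{1..m}. \<one>)"
      by (intro restrict_ext)
    moreover have "?e \<in> {1..n} \<rightarrow>\<^sub>E carrier G"
      by simp
    ultimately have "arr (segal_H G) n m \<phi> (snd (obj (segal_H G) n)) = snd (obj (segal_H G) m)"
      by (simp only: segal_H_def fin_functor.simps snd_conv restrict_apply')
    moreover have "arr (segal_H G) n m \<phi> \<in> fst (obj (segal_H G) n) \<rightarrow>\<^sub>E fst (obj (segal_H G) m)"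
      using segal_H_arr_closed[OF \<phi>] by (simp add: segal_H_def)
    ultimately show ?thesis
      by (simp add: pointed_hom_def)
  qed
  show "arr (segal_H G) n n (fin_id n) = pointed_id (obj (segal_H G) n)" for n
  proof -
    have "(\<lambda>j\<in>{1..n}. \<Otimes>i\<in>{i \<in> {0..n}. fin_id n i = j}. a i) = a"
      if a: "a \<in> {1..n} \<rightarrow>\<^sub>E carrier G" for a
    proof (rule extensionalityI[where A = "{1..n}"])
      fix j assume j: "j \<in> {1..n}"
      then have "{i \<in> {0..n}. fin_id n i = j} = {j}"
        by (auto simp: fin_id_def)
      moreover have "finprod G a {j} = a j"
        using PiE_mem[OF a j] by (simp add: Pi_def)
      ultimately show "(\<lambda>j\<in>{1..n}. \<Otimes>i\<in>{i \<in> {0..n}. fin_id n i = j}. a i) j = a j"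
        using j by simp
    qed (use a in \<open>auto simp: PiE_def\<close>)
    then show ?thesis
      by (auto simp: segal_H_def pointed_id_def intro!: restrict_ext)
  qed
  show "arr (segal_H G) n k (fin_comp n \<psi> \<phi>)
      = pointed_comp (obj (segal_H G) n) (arr (segal_H G) m k \<psi>) (arr (segal_H G) n m \<phi>)"
    if \<phi>: "\<phi> \<in> fin_hom n m" and \<psi>: "\<psi> \<in> fin_hom m k" for \<phi> \<psi> n m k
  proof -
    have "arr (segal_H G) n k (fin_comp n \<psi> \<phi>) a
        = arr (segal_H G) m k \<psi> (arr (segal_H G) n m \<phi> a)"
      if a: "a \<in> {1..n} \<rightarrow>\<^sub>E carrier G" for a
    proof -
      have closed: "arr (segal_H G) n m \<phi> a \<in> {1..m} \<rightarrow>\<^sub>E carrier G"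
        using segal_H_arr_closed[OF \<phi> a] a by (simp add: segal_H_def)
      have "(\<Otimes>i\<in>{i \<in> {0..n}. fin_comp n \<psi> \<phi> i = l}. a i)
          = finprod G (arr (segal_H G) n m \<phi> a) {j \<in> {0..m}. \<psi> j = l}" if l: "l \<in> {1..k}" for l
        using finprod_segal_H_arr[OF \<phi> a fin_hom_fibre_subset[OF \<psi> l]]
          fin_comp_preimage[OF \<phi>, of \<psi> "{l}"] by simp
      then show ?thesis
        using a closed by (simp add: segal_H_def cong: restrict_cong)
    qed
    then have "restrict (arr (segal_H G) n k (fin_comp n \<psi> \<phi>)) (fst (obj (segal_H G) n))
        = pointed_comp (obj (segal_H G) n) (arr (segal_H G) m k \<psi>) (arr (segal_H G) n m \<phi>)"
      unfolding pointed_comp_def compose_def by (intro restrict_ext) (simp add: segal_H_def)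
    then show ?thesis
      by (simp add: segal_H_def)
  qed
  show "\<exists>x. fst (obj (segal_H G) 0) = {x}"
    by (simp add: segal_H_def)
qed


section \<open>Tuples as additive families\<close>

abbreviation sum_family :: "nat \<Rightarrow> (nat \<Rightarrow> 'a) \<Rightarrow> nat set \<Rightarrow> 'a" where
  "sum_family n \<equiv> \<lambda>a \<in> {1..n} \<rightarrow>\<^sub>E carrier G. \<lambda>S \<in> Pow {1..n}. finprod G a S"

abbreviation singleton_values :: "nat \<Rightarrow> (nat set \<Rightarrow> 'a) \<Rightarrow> nat \<Rightarrow> 'a" where
  "singleton_values n \<equiv> \<lambda>x \<in> hat_H_set (plasma_of_monoid G) n. \<lambda>i\<in>{1..n}. x {i}"

lemma hat_H_set_plasma_of_monoid:
  "hat_H_set (plasma_of_monoid G) n =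
     {x \<in> Pow {1..n} \<rightarrow>\<^sub>E carrier G. x {} = \<one> \<and>
        (\<forall>S T. S \<subseteq> {1..n} \<and> T \<subseteq> {1..n} \<and> S \<inter> T = {} \<longrightarrow> x (S \<union> T) = x S \<otimes> x T)}"
  by (simp add: hat_H_set_def plasma_of_monoid_def)

lemma hat_H_set_additive:
  assumes "x \<in> hat_H_set (plasma_of_monoid G) n"
    and "S \<subseteq> {1..n}" and "T \<subseteq> {1..n}" and "S \<inter> T = {}"
  shows "x (S \<union> T) = x S \<otimes> x T"
  using assms by (simp add: hat_H_set_plasma_of_monoid)

lemma sum_family_closed:
  assumes a: "a \<in> {1..n} \<rightarrow>\<^sub>E carrier G"
  shows "sum_family n a \<in> hat_H_set (plasma_of_monoid G) n"
proof -
  have carr: "a \<in> S \<rightarrow> carrier G" if "S \<subseteq> {1..n}" for S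
    using a that by blast
  have "finprod G a (S \<union> T) = finprod G a S \<otimes> finprod G a T"
    if "S \<subseteq> {1..n}" "T \<subseteq> {1..n}" "S \<inter> T = {}" for S T
    using that carr by (intro finprod_Un_disjoint) (auto intro: finite_subset)
  then show ?thesis
    using a carr by (auto simp: hat_H_set_plasma_of_monoid simp del: atLeastAtMost_iff)
qed

text \<open>An additive family is determined by its values on singletons, by adding the elements of
  \<open>S\<close> one at a time.\<close>

lemma hat_H_set_eq_finprod:
  assumes x: "x \<in> hat_H_set (plasma_of_monoid G) n" and S: "S \<subseteq> {1..n}"
  shows "x S = (\<Otimes>i\<in>S. x {i})"
proof -
  have "finite S"
    using S by (rule finite_subset) simp
  then show ?thesis
    using S
  proof (induction S rule: finite_induct)
    case empty
    then show ?case
      using x by (simp add: hat_H_set_plasma_of_monoid)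
  next
    case (insert i S)
    have carr: "x {j} \<in> carrier G" if "j \<in> insert i S" for j
      using x insert.prems that by (auto simp: hat_H_set_plasma_of_monoid PiE_iff)
    have "x (insert i S) = x {i} \<otimes> x S"
      using hat_H_set_additive[OF x, of "{i}" S] insert.prems insert.hyps by simp
    then show ?case
      using insert carr by simp
  qed
qed

lemma sum_family_hom:
  "sum_family n \<in> pointed_hom (obj (segal_H G) n) (obj (hat_H (plasma_of_monoid G)) n)"
proof -
  have "finprod G (\<lambda>i\<in>{1..n}. \<one>) S = \<one>" if "S \<subseteq> {1..n}" for S
    using that by (intro finprod_one_eqI) auto
  then have "(\<lambda>S\<in>Pow {1..n}. finprod G (\<lambda>i\<in>{1..n}. \<one>) S) = (\<lambda>S\<in>Pow {1..n}. \<one>)"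
    by (intro restrict_ext) auto
  then show ?thesis
    using sum_family_closed
    by (auto simp: pointed_hom_def segal_H_def hat_H_def plasma_of_monoid_def)
qed

lemma singleton_values_hom:
  "singleton_values n \<in> pointed_hom (obj (hat_H (plasma_of_monoid G)) n) (obj (segal_H G) n)"
proof -
  have "(\<lambda>S \<in> Pow {1..n}. \<one>) \<in> hat_H_set (plasma_of_monoid G) n"
    by (auto simp: hat_H_set_plasma_of_monoid)
  moreover have "(\<lambda>i\<in>{1..n}. x {i}) \<in> {1..n} \<rightarrow>\<^sub>E carrier G"
    if "x \<in> hat_H_set (plasma_of_monoid G) n" for x
    using that by (auto simp: hat_H_set_plasma_of_monoid PiE_iff)
  ultimately show ?thesis
    by (auto simp: pointed_hom_def segal_H_def hat_H_def plasma_of_monoid_def intro!: restrict_ext)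
qed

lemma sum_family_iso:
  "sum_family n \<in> pointed_iso (obj (segal_H G) n) (obj (hat_H (plasma_of_monoid G)) n)"
proof -
  let ?A = "obj (segal_H G) n" and ?B = "obj (hat_H (plasma_of_monoid G)) n"
  have A: "fst ?A = {1..n} \<rightarrow>\<^sub>E carrier G"
    and B: "fst ?B = hat_H_set (plasma_of_monoid G) n"
    by (simp_all add: segal_H_def hat_H_def)
  have "singleton_values n (sum_family n a) = a" if a: "a \<in> {1..n} \<rightarrow>\<^sub>E carrier G" for a
  proof (rule extensionalityI[where A = "{1..n}"])
    fix i assume i: "i \<in> {1..n}"
    have "finprod G a {i} = a i"
      using PiE_mem[OF a i] by (simp add: Pi_def)
    then show "singleton_values n (sum_family n a) i = a i"
      using i a sum_family_closed[OF a] by simp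
  qed (use a sum_family_closed[OF a] in \<open>auto simp: PiE_def\<close>)
  then have gf: "pointed_comp ?A (singleton_values n) (sum_family n) = pointed_id ?A"
    unfolding pointed_comp_def pointed_id_def compose_def A by (intro restrict_ext)
  have "sum_family n (singleton_values n x) = x"
    if x: "x \<in> hat_H_set (plasma_of_monoid G) n" for x
  proof (rule extensionalityI[where A = "Pow {1..n}"])
    have carr: "singleton_values n x \<in> {1..n} \<rightarrow>\<^sub>E carrier G"
      using x by (auto simp: hat_H_set_plasma_of_monoid PiE_iff)
    show "sum_family n (singleton_values n x) \<in> extensional (Pow {1..n})"
      using carr by simp
    show "x \<in> extensional (Pow {1..n})"
      using x by (auto simp: hat_H_set_plasma_of_monoid PiE_def)
    fix S assume "S \<in> Pow {1..n}"
    then have S: "S \<subseteq> {1..n}" by simp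
    have "finprod G (singleton_values n x) S = (\<Otimes>i\<in>S. x {i})"
      using x S by (intro finprod_cong') (auto simp: hat_H_set_plasma_of_monoid PiE_iff)
    then show "sum_family n (singleton_values n x) S = x S"
      using S carr hat_H_set_eq_finprod[OF x S] by simp
  qed
  then have fg: "pointed_comp ?B (sum_family n) (singleton_values n) = pointed_id ?B"
    unfolding pointed_comp_def pointed_id_def compose_def B by (intro restrict_ext)
  show ?thesis
    unfolding pointed_iso_def using sum_family_hom singleton_values_hom gf fg by blast
qed

lemma sum_family_natural:
  assumes \<phi>: "\<phi> \<in> fin_hom n m" and a: "a \<in> {1..n} \<rightarrow>\<^sub>E carrier G"
  shows "sum_family m (arr (segal_H G) n m \<phi> a)
    = arr (hat_H (plasma_of_monoid G)) n m \<phi> (sum_family n a)"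
proof -
  have "arr (segal_H G) n m \<phi> a \<in> {1..m} \<rightarrow>\<^sub>E carrier G"
    using segal_H_arr_closed[OF \<phi> a] a by (simp add: segal_H_def)
  then show ?thesis
    using a sum_family_closed[OF a] finprod_segal_H_arr[OF \<phi> a] fin_hom_preimage_subset[OF \<phi>]
    by (auto simp: hat_H_def simp del: atLeastAtMost_iff mem_Collect_eq intro!: restrict_ext)
qed

lemma segal_H_naturally_isomorphic_hat_H:
  "naturally_isomorphic (segal_H G) (hat_H (plasma_of_monoid G))"
proof -
  interpret S: F1_module "segal_H G"
    by (rule segal_H_F1_module)
  interpret T: F1_module "hat_H (plasma_of_monoid G)"
    by (rule plasma.hat_H_F1_module[OF plasma_plasma_of_monoid])
  have "natural_isomorphism (segal_H G) (hat_H (plasma_of_monoid G)) sum_family"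
  proof
    show "pointed_comp (obj (segal_H G) n) (sum_family m) (arr (segal_H G) n m \<phi>)
        = pointed_comp (obj (segal_H G) n) (arr (hat_H (plasma_of_monoid G)) n m \<phi>) (sum_family n)"
      if "\<phi> \<in> fin_hom n m" for \<phi> n m
      unfolding pointed_comp_def compose_def
      by (rule restrict_ext, rule sum_family_natural[OF that]) (simp add: segal_H_def)
  qed (rule sum_family_hom sum_family_iso)+
  then show ?thesis
    unfolding naturally_isomorphic_def by blast
qed

end


theorem theorem4p17:
  fixes M :: "('a, 'b) monoid_scheme"
  assumes "comm_monoid M"
  shows "F1_module (segal_H M)
    \<and> F1_module (hat_H (plasma_of_monoid M))
    \<and> naturally_isomorphic (segal_H M) (hat_H (plasma_of_monoid M))"
proof -
  interpret comm_monoid M by fact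
  show ?thesis
    using segal_H_F1_module plasma.hat_H_F1_module[OF plasma_plasma_of_monoid]
      segal_H_naturally_isomorphic_hat_H by blast
qed

end
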